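(* Let $\mathcal{C}$ be the unit circle centered at the origin of the $xy$-plane in $\mathbb{R}^3$, with constant density $\lambda>0$ and potential $V(\mathbf{r})=-\int_{\mathcal{C}}\frac{\lambda\,du}{\|\mathbf{r}-u\|}$. Write $V(r)=V(r\mathbf{u})$ for any unit vector $\mathbf{u}$ in the $xy$-plane, and for $K\in\mathbb{R}$ let $U(r)=\frac{K^2}{2r^2}+V(r)$, $r>1$ (the effective potential outside the circle, which depends on $K$). Then: (i) $\frac{d}{dr}V(r)>0$; hence $\frac{d}{dr}\left(U(r)-\frac{K^2}{2r^2}\right)>0$. (ii) $\lim_{r\to1^+}U(r)=-\infty$. (iii) $\lim_{r\to\infty}U(r)=0$. Moreover, there are $K_0>0$, $r_0$ with $1<r_0<2$, and continuous functions $r_1=r_1(|K|)$, $r_2=r_2(|K|)$ defined for $|K|\ge K_0$, with $1<r_1\le r_0\le r_2$, such that: (iv) For $K\in(-K_0,K_0)$, $U(r)$ has no critical points; hence, by (ii), $\frac{d}{dr}U(r)>0$ and $U$ is an increasing function. (v) For $K\notin(-K_0,K_0)$, the critical points of $U(r)$ are exactly $r_1(|K|)$ and $r_2(|K|)$. (vi) For $K\notin(-K_0,K_0)$, $\frac{d}{dr}U(r)>0$ for $r<r_1$ and for $r>r_2$, and $\frac{d}{dr}U(r)<0$ for $r_1<r<r_2$. (vii) $r_1(K_0)=r_2(K_0)=r_0$. (viii) $r_1$ is a decreasing function and $\lim_{K\to\infty}r_1(K)=1$. (ix) $r_2$ is an increasing function and $\lim_{K\to\infty}r_2(K)=\infty$.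 (x) $\lim_{K\to\infty}U(r_1(K))=\infty$ and $\lim_{K\to\infty}U(r_2(K))=0$, where for each $K$ the function $U$ is the one with that value of $K$.
   Context: $du$ denotes arc length on $\mathcal{C}$. By rotational symmetry about the $z$-axis, $V(r\mathbf{u})$ does not depend on the choice of the unit vector $\mathbf{u}$ in the $xy$-plane. The constant $K$ is the angular momentum of a planar solution of $\ddot{\mathbf{r}}=-\nabla V(\mathbf{r})$. *)

theory Defs
  imports "HOL-Analysis.Analysis"
begin

definition unit_circle :: "(real^3) set"
  where "unit_circle = {x. norm x = 1 \<and> x $ 3 = 0}"

definition circle_path :: "real \<Rightarrow> real^3"
  where "circle_path t = vector [cos (2 * pi * t), sin (2 * pi * t), 0]"

definition arclength_integral :: "(real \<Rightarrow> 'a::euclidean_space) \<Rightarrow> ('a \<Rightarrow> real) \<Rightarrow> real"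
  where "arclength_integral g f =
    integral {0..1} (\<lambda>t. f (g t) * norm (vector_derivative g (at t within {0..1})))"

(* Minus the arc-length integral of lam / norm (x - u) over u in unit_circle, which circle_path
   runs through once (mem_unit_circle_iff, circle_path_inj). Only meaningful off the circle: on it
   the integral diverges and integral returns 0. *)
definition circle_potential :: "real \<Rightarrow> real^3 \<Rightarrow> real"
  where "circle_potential lam x = - arclength_integral circle_path (\<lambda>u. lam / norm (x - u))"

(* The choice of the first basis vector is immaterial, see circle_potential_rotation below. *)
definition radial_potential :: "real \<Rightarrow> real \<Rightarrow> real"
  where "radial_potential lam r = circle_potential lam (r *\<^sub>R axis 1 1)"

definition effective_potential :: "real \<Rightarrow> real \<Rightarrow> real \<Rightarrow> real"
  where "effective_potential lam K r = K\<^sup>2 / (2 * r\<^sup>2) + radial_potential lam r"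

definition critical_point :: "(real \<Rightarrow> real) \<Rightarrow> real \<Rightarrow> bool"
  where "critical_point f r \<longleftrightarrow> (f has_real_derivative 0) (at r)"

lemma norm_vec3: "norm (x :: real^3) = sqrt ((x$1)\<^sup>2 + (x$2)\<^sup>2 + (x$3)\<^sup>2)"
  by (simp add: norm_vec_def L2_set_def sum_3)

lemma mem_unit_circle_iff:
  "x \<in> unit_circle \<longleftrightarrow> (\<exists>t\<in>{0..<1}. x = circle_path t)"
proof
  assume "x \<in> unit_circle"
  then have x: "(x$1)\<^sup>2 + (x$2)\<^sup>2 = 1" "x$3 = 0"
    by (auto simp: unit_circle_def norm_vec3)
  obtain s where s: "0 \<le> s" "s < 2 * pi" "x$1 = cos s" "x$2 = sin s"
    using sincos_total_2pi[OF x(1)] by metis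
  have "x = circle_path (s / (2 * pi))" "s / (2 * pi) \<in> {0..<1}"
    using s x(2) by (auto simp: circle_path_def vec_eq_iff forall_3)
  then show "\<exists>t\<in>{0..<1}. x = circle_path t" by blast
next
  assume "\<exists>t\<in>{0..<1}. x = circle_path t"
  then show "x \<in> unit_circle"
    by (auto simp: circle_path_def unit_circle_def norm_vec3)
qed

lemma circle_path_inj: "inj_on circle_path {0..<1}"
proof (rule inj_onI)
  fix s t assume st: "s \<in> {0..<1}" "t \<in> {0..<1}" and eq: "circle_path s = circle_path t"
  from eq have "cos (2 * pi * s) = cos (2 * pi * t)" "sin (2 * pi * s) = sin (2 * pi * t)"
    by (auto simp: circle_path_def vec_eq_iff forall_3)
  then obtain n :: int where "2 * pi * s = 2 * pi * t + 2 * pi * n"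
    using sin_cos_eq_iff by blast
  then have "2 * pi * s = 2 * pi * (t + n)" by (simp add: algebra_simps)
  then have n: "s = t + n" by simp
  with st have "\<bar>real_of_int n\<bar> < 1" by auto
  then have "n = 0" by linarith
  with n show "s = t" by simp
qed

lemma circle_path_vector_derivative:
  "(circle_path has_vector_derivative
      vector [- (2 * pi * sin (2 * pi * t)), 2 * pi * cos (2 * pi * t), 0]) (at t within S)"
proof -
  have eq: "vector [a, b, 0] = a *\<^sub>R axis 1 1 + b *\<^sub>R (axis 2 1 :: real^3)" for a b
    by (simp add: vec_eq_iff forall_3 axis_def)
  show ?thesis
    unfolding circle_path_def[abs_def] eq
    by (auto intro!: derivative_eq_intros simp: algebra_simps)
qed

lemma arclength_integral_circle:
  "arclength_integral circle_path f = integral {0..1} (\<lambda>t. f (circle_path t) * (2 * pi))"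
proof -
  have "norm (vector_derivative circle_path (at t within {0..1})) = 2 * pi" if "t \<in> {0..1}" for t
  proof -
    have "vector_derivative circle_path (at t within {0..1}) =
        vector [- (2 * pi * sin (2 * pi * t)), 2 * pi * cos (2 * pi * t), 0]"
      using circle_path_vector_derivative that by (intro vector_derivative_within_closed_interval) auto
    moreover have "(2 * pi * sin (2 * pi * t))\<^sup>2 + (2 * pi * cos (2 * pi * t))\<^sup>2 = (2 * pi)\<^sup>2"
      by (simp add: power_mult_distrib flip: distrib_left)
    ultimately show ?thesis by (simp add: norm_vec3 real_sqrt_mult)
  qed
  then show ?thesis
    unfolding arclength_integral_def by (intro integral_cong) simp
qed

lemma integral_periodic_shift:
  fixes g :: "real \<Rightarrow> real"
  assumes cont: "continuous_on UNIV g" and per: "\<And>t. g (t + 1) = g t" and a: "0 \<le> a" "a \<le> 1"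
  shows "integral {0..1} (\<lambda>t. g (t - a)) = integral {0..1} g"
proof -
  have int: "g integrable_on {c..d}" for c d
    by (rule integrable_continuous_real) (rule continuous_on_subset[OF cont], simp)
  have "integral {0..1} (\<lambda>t. g (t - a)) = integral {-a..1-a} g"
    using integral_shift_real_ivl[where f=g and a="-a" and b="1-a" and c="-a"] by simp
  also have "\<dots> = integral {-a..0} g + integral {0..1-a} g"
    using a int by (intro Henstock_Kurzweil_Integration.integral_combine[symmetric]) auto
  also have "integral {-a..0} g = integral {1-a..1} g"
    using integral_shift_real_ivl[where f=g and a="1-a" and b="1" and c=1] by (simp add: per)
  also have "integral {1-a..1} g + integral {0..1-a} g = integral {0..1} g"
    using a int by (subst add.commute, intro Henstock_Kurzweil_Integration.integral_combine) auto
  finally show ?thesis .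
qed

lemma circle_potential_rotation:
  assumes u: "norm u = 1" "u $ 3 = 0" and r: "r > 1"
  shows "circle_potential lam (r *\<^sub>R u) = radial_potential lam r"
proof -
  define g where "g t = lam / sqrt (1 + r\<^sup>2 - 2 * r * cos (2 * pi * t)) * (2 * pi)" for t
  have pos: "1 + r\<^sup>2 - 2 * r * cos s > 0" for s
  proof -
    have "2 * r * cos s \<le> 2 * r * 1" using r by (intro mult_left_mono) auto
    moreover have "(r - 1)\<^sup>2 > 0" using r by simp
    ultimately show ?thesis by (simp add: power2_eq_square algebra_simps)
  qed
  have cont: "continuous_on UNIV g"
    unfolding g_def using pos by (intro continuous_intros) (auto simp: less_imp_neq[symmetric])
  have per: "g (t + 1) = g t" for t
    by (simp add: g_def distrib_left)
  have key: "circle_potential lam (r *\<^sub>R circle_path a) = - integral {0..1} (\<lambda>t. g (t - a))" for a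
  proof -
    have "norm (r *\<^sub>R circle_path a - circle_path t) =
        sqrt (1 + r\<^sup>2 - 2 * r * cos (2 * pi * (t - a)))" for t
    proof -
      have "(r * cos p - cos q)\<^sup>2 + (r * sin p - sin q)\<^sup>2 =
          r\<^sup>2 * ((sin p)\<^sup>2 + (cos p)\<^sup>2) + ((sin q)\<^sup>2 + (cos q)\<^sup>2)
            - 2 * r * (cos q * cos p + sin q * sin p)" for p q
        by algebra
      then show ?thesis
        by (simp add: norm_vec3 circle_path_def right_diff_distrib cos_diff)
    qed
    then show ?thesis
      by (simp add: circle_potential_def arclength_integral_circle g_def)
  qed
  have main: "circle_potential lam (r *\<^sub>R v) = - integral {0..1} g" if "v \<in> unit_circle" for v
    using that key cont per integral_periodic_shift[of g]
    by (auto simp: mem_unit_circle_iff)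
  have "axis 1 1 \<in> unit_circle"
    by (simp add: unit_circle_def axis_def norm_vec3)
  with u main show ?thesis
    by (simp add: radial_potential_def unit_circle_def)
qed

end

theory Submission
  imports Defs "HOL-Real_Asymp.Real_Asymp"
begin

text \<open>
  Outside the circle the potential has the Legendre-type expansion
  \<open>V(r) = -(2 \<pi> \<lambda> / r) \<Sum>n. a\<^sub>n r\<^sup>-\<^sup>2\<^sup>n\<close>, where \<open>a\<^sub>n = c\<^sub>n\<^sup>2\<close> and the \<open>c\<^sub>n\<close> are the Taylor
  coefficients of \<open>(1 - z)\<^sup>-\<^sup>1\<^sup>/\<^sup>2\<close>: with \<open>z = e\<^sup>i\<^sup>\<theta> / r\<close>, the reciprocal distance to a point of the
  circle is \<open>1/r\<close> times the squared modulus of \<open>(1 - z)\<^sup>-\<^sup>1\<^sup>/\<^sup>2\<close>, so the integral over \<open>\<theta>\<close> is an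
  instance of Parseval's identity (\<open>integral_inverse_distance\<close>, \<open>radial_potential_eq\<close>).
  Everything then becomes a statement about power series in \<open>x = 1 / r\<^sup>2\<close> with explicit
  coefficients.

  Put \<open>G(r) = r\<^sup>3 V'(r)\<close>. Since \<open>U'(r) = (G(r) - K\<^sup>2) / r\<^sup>3\<close>, the critical points of \<open>U\<close> are the
  solutions of \<open>G(r) = K\<^sup>2\<close>, and the sign of \<open>U'\<close> is that of \<open>G - K\<^sup>2\<close>. Termwise
  differentiation gives \<open>G(r) = 2 \<pi> \<lambda> r \<Sum>n. (2n + 1) a\<^sub>n x\<^sup>n\<close> and
  \<open>G'(r) = -2 \<pi> \<lambda> B(x)\<close> with \<open>B(x) = \<Sum>n. (4n\<^sup>2 - 1) a\<^sub>n x\<^sup>n\<close>. All coefficients of \<open>B\<close> but the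
  constant one are positive, so \<open>B\<close> is strictly increasing; it is negative at \<open>1/4\<close> and positive
  at \<open>3/4\<close>. Hence \<open>G\<close> strictly decreases and then strictly increases, and its minimum \<open>r\<^sub>0\<close> lies
  in \<open>(1, 2)\<close> (\<open>moment_valley\<close>). As \<open>G\<close> tends to infinity at both ends, each level \<open>K\<^sup>2\<close> above
  \<open>K\<^sub>0\<^sup>2 = G(r\<^sub>0)\<close> is attained once on either side of \<open>r\<^sub>0\<close>, at \<open>r\<^sub>1\<close> and \<open>r\<^sub>2\<close>, which are the
  inverses of the two monotone branches of \<open>\<surd>G\<close> (\<open>valley_level_branches\<close>).

  The behaviour at \<open>r = 1\<close> rests on the bound \<open>n a\<^sub>n \<ge> 1/4\<close>, which makes \<open>V\<close> diverge at least
  logarithmically and \<open>G\<close> at least like \<open>1 / (1 - x)\<close>. At a critical point, \<open>U\<close> equals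
  \<open>G(r) / (2 r\<^sup>2) + V(r) = (\<pi> \<lambda> / r) \<Sum>n. (2n - 1) a\<^sub>n x\<^sup>n\<close>, a function of \<open>r\<close> alone, and the
  same bound shows that it tends to infinity as \<open>r\<close> tends to \<open>1\<close>.
\<close>

section \<open>Power series on the unit disc\<close>

definition powser :: "(nat \<Rightarrow> real) \<Rightarrow> real \<Rightarrow> real"
  where "powser d x = (\<Sum>n. d n * x ^ n)"

text \<open>Multiplying the coefficients by \<open>n\<close> is the Euler operator \<open>x d/dx\<close>. Hence a factor linear in \<open>n\<close>
  preserves convergence on the unit disc; this rule, iterated, covers all series below.\<close>

lemma powser_linear_weight:
  assumes d: "\<And>x. \<bar>x\<bar> < 1 \<Longrightarrow> summable (\<lambda>n. d n * x ^ n)" and x: "\<bar>x\<bar> < 1"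
  shows "summable (\<lambda>n. (p + q * real n) * d n * x ^ n)"
    and "(powser d has_real_derivative (\<Sum>n. diffs d n * x ^ n)) (at x)"
    and "powser (\<lambda>n. (p + q * real n) * d n) x = p * powser d x + q * (x * (\<Sum>n. diffs d n * x ^ n))"
proof -
  show "(powser d has_real_derivative (\<Sum>n. diffs d n * x ^ n)) (at x)"
    unfolding powser_def[abs_def] using d x by (intro termdiffs_strong') auto
  have "summable (\<lambda>n. diffs d n * x ^ n)"
    using d x by (intro termdiff_converges) auto
  then have "(\<lambda>n. x * (real n * d n * x ^ (n - Suc 0))) sums (x * (\<Sum>n. diffs d n * x ^ n))"
    by (intro sums_mult diffs_equiv)
  also have "(\<lambda>n. x * (real n * d n * x ^ (n - Suc 0))) = (\<lambda>n. real n * d n * x ^ n)"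
  proof
    fix n show "x * (real n * d n * x ^ (n - Suc 0)) = real n * d n * x ^ n"
      by (cases n) simp_all
  qed
  finally have "(\<lambda>n. p * (d n * x ^ n) + q * (real n * d n * x ^ n)) sums
      (p * powser d x + q * (x * (\<Sum>n. diffs d n * x ^ n)))"
    unfolding powser_def using d[OF x] by (intro sums_add sums_mult) (auto simp: summable_sums)
  then have sums: "(\<lambda>n. (p + q * real n) * d n * x ^ n) sums
      (p * powser d x + q * (x * (\<Sum>n. diffs d n * x ^ n)))"
    by (simp add: algebra_simps)
  show "summable (\<lambda>n. (p + q * real n) * d n * x ^ n)"
    using sums by (rule sums_summable)
  show "powser (\<lambda>n. (p + q * real n) * d n) x = p * powser d x + q * (x * (\<Sum>n. diffs d n * x ^ n))"
    using sums by (simp add: powser_def sums_iff)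
qed

lemma continuous_on_powser:
  assumes d: "\<And>x. \<bar>x\<bar> < 1 \<Longrightarrow> summable (\<lambda>n. d n * x ^ n)" and S: "S \<subseteq> {-1<..<1}"
  shows "continuous_on S (powser d)"
proof (rule continuous_at_imp_continuous_on, rule ballI)
  fix x assume "x \<in> S"
  with S have "- 1 < x" "x < 1" by auto
  then show "isCont (powser d) x"
    by (intro DERIV_isCont[OF powser_linear_weight(2)] d) auto
qed

text \<open>The \<open>n\<close>-th term is \<open>d n\<close> times the power \<open>m - 2n\<close> of \<open>r\<close>, so termwise differentiation
  multiplies the coefficients by \<open>m - 2n\<close>. Both \<open>V\<close> (\<open>m = -1\<close>) and \<open>r\<^sup>3 V'\<close> (\<open>m = 1\<close>) have this
  form.\<close>

lemma DERIV_powi_mult_powser: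
  assumes d: "\<And>x. \<bar>x\<bar> < 1 \<Longrightarrow> summable (\<lambda>n. d n * x ^ n)" and r: "r > 1"
  shows "((\<lambda>r. r powi m * powser d (1 / r\<^sup>2)) has_real_derivative
    r powi (m - 1) * powser (\<lambda>n. (of_int m - 2 * real n) * d n) (1 / r\<^sup>2)) (at r)"
proof -
  define x where "x = 1 / r\<^sup>2"
  define D where "D = (\<Sum>n. diffs d n * x ^ n)"
  have x: "\<bar>x\<bar> < 1" using r by (simp add: x_def)
  have "((\<lambda>r. 1 / r\<^sup>2) has_real_derivative - 2 * x / r) (at r)"
    using r by (auto intro!: derivative_eq_intros simp: x_def field_simps power2_eq_square)
  from DERIV_chain2[OF _ this] powser_linear_weight(2)[OF d x]
  have inner: "((\<lambda>r. powser d (1 / r\<^sup>2)) has_real_derivative D * (- 2 * x / r)) (at r)"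
    by (simp add: x_def D_def)
  have "((\<lambda>r. r powi m * powser d (1 / r\<^sup>2)) has_real_derivative
      of_int m * r powi (m - 1) * powser d x + D * (- 2 * x / r) * r powi m) (at r)"
    using DERIV_mult[OF DERIV_power_int[OF DERIV_ident] inner, of m] r by (simp add: x_def)
  also have "r powi m = r powi (m - 1) * r"
    using r by (simp flip: power_int_add_1)
  also have "of_int m * r powi (m - 1) * powser d x + D * (- 2 * x / r) * (r powi (m - 1) * r) =
      r powi (m - 1) * (of_int m * powser d x + (-2) * (x * D))"
    using r by (simp add: field_simps)
  also have "of_int m * powser d x + (-2) * (x * D) = powser (\<lambda>n. (of_int m + (-2) * real n) * d n) x"
    unfolding D_def by (rule powser_linear_weight(3)[OF d x, symmetric])
  finally show ?thesis by (simp add: x_def)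
qed

lemma powser_strict_mono:
  assumes d: "\<And>x. \<bar>x\<bar> < 1 \<Longrightarrow> summable (\<lambda>n. d n * x ^ n)"
    and pos: "\<And>n. n > 0 \<Longrightarrow> d n > 0" and xy: "0 \<le> x" "x < y" "y < 1"
  shows "powser d x < powser d y"
proof -
  have sums: "(\<lambda>n. d n * y ^ n - d n * x ^ n) sums (powser d y - powser d x)"
    unfolding powser_def using d xy by (intro sums_diff summable_sums) auto
  have "0 < (\<Sum>n. d n * y ^ n - d n * x ^ n)"
  proof (rule suminf_pos2[where i=1])
    fix n show "0 \<le> d n * y ^ n - d n * x ^ n"
    proof (cases "n = 0")
      case False
      then show ?thesis using pos[of n] xy by (simp add: power_mono)
    qed simp
  qed (use sums pos xy in \<open>auto simp: sums_iff\<close>)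
  then show ?thesis using sums by (simp add: sums_iff)
qed

text \<open>Compare termwise with one quarter of the geometric series, whose constant term is lowered by
  \<open>5/4\<close> to make room for the possible constant coefficient \<open>-1\<close>.\<close>

lemma powser_ge_geometric:
  assumes d: "\<And>x. \<bar>x\<bar> < 1 \<Longrightarrow> summable (\<lambda>n. d n * x ^ n)"
    and d0: "d 0 \<ge> -1" and dn: "\<And>n. n > 0 \<Longrightarrow> d n \<ge> 1/4" and x: "0 \<le> x" "x < 1"
  shows "powser d x \<ge> 1 / (4 * (1 - x)) - 5/4"
proof -
  have geo: "(\<lambda>n. 1/4 * x ^ n - (if n = 0 then 5/4 else 0)) sums (1/4 * (1 / (1 - x)) - 5/4)"
    using x sums_single[of 0 "\<lambda>_. 5/4 :: real"]
    by (intro sums_diff sums_mult geometric_sums) auto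
  have "1/4 * x ^ n - (if n = 0 then 5/4 else 0) \<le> d n * x ^ n" for n
    using d0 mult_right_mono[OF dn, of n "x ^ n"] x by (cases "n = 0") simp_all
  then have "1/4 * (1 / (1 - x)) - 5/4 \<le> powser d x"
    unfolding powser_def using x by (intro sums_le[OF _ geo summable_sums] d) auto
  then show ?thesis by simp
qed

lemma tendsto_powser_at_top:
  assumes "\<And>x. \<bar>x\<bar> < 1 \<Longrightarrow> summable (\<lambda>n. d n * x ^ n)"
  shows "((\<lambda>r. powser d (1 / r\<^sup>2)) \<longlongrightarrow> d 0) at_top"
proof -
  have "isCont (powser d) 0"
    using assms by (intro DERIV_isCont[OF powser_linear_weight(2)]) auto
  moreover have "((\<lambda>r::real. 1 / r\<^sup>2) \<longlongrightarrow> 0) at_top" by real_asymp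
  ultimately have "((\<lambda>r. powser d (1 / r\<^sup>2)) \<longlongrightarrow> powser d 0) at_top"
    by (rule isCont_tendsto_compose)
  then show ?thesis by (simp add: powser_def)
qed

section \<open>Taylor coefficients of the inverse square root\<close>

text \<open>The Taylor coefficients \<open>(2n choose n) / 4\<^sup>n\<close> of \<open>(1 - z)\<^sup>-\<^sup>1\<^sup>/\<^sup>2\<close>, as ratios of a rising
  factorial because this form yields the recurrence immediately.\<close>

definition inv_sqrt_coeff :: "nat \<Rightarrow> real"
  where "inv_sqrt_coeff n = pochhammer (1/2) n / fact n"

lemma inv_sqrt_coeff_0 [simp]: "inv_sqrt_coeff 0 = 1"
  by (simp add: inv_sqrt_coeff_def)

lemma inv_sqrt_coeff_Suc:
  "inv_sqrt_coeff (Suc n) = inv_sqrt_coeff n * ((2 * real n + 1) / (2 * real n + 2))"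
  by (simp add: inv_sqrt_coeff_def pochhammer_Suc field_simps)

lemma inv_sqrt_coeff_pos: "inv_sqrt_coeff n > 0"
  by (induction n) (simp_all add: inv_sqrt_coeff_Suc add_pos_nonneg)

lemma inv_sqrt_coeff_le_1: "inv_sqrt_coeff n \<le> 1"
proof (induction n)
  case (Suc n)
  then have "inv_sqrt_coeff n * ((2 * real n + 1) / (2 * real n + 2)) \<le> 1 * 1"
    using inv_sqrt_coeff_pos[of n] by (intro mult_mono) auto
  then show ?case unfolding inv_sqrt_coeff_Suc by linarith
qed simp

text \<open>The sign \<open>(-1)\<^sup>n\<close> in the binomial coefficients of exponent \<open>-1/2\<close> cancels that of \<open>(-z)\<^sup>n\<close>.\<close>

lemma inv_sqrt_coeff_sums:
  fixes z :: complex
  assumes "norm z < 1"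
  shows "(\<lambda>n. of_real (inv_sqrt_coeff n) * z ^ n) sums (1 - z) powr (- 1/2)"
proof -
  have "(\<lambda>n. ((- 1/2) gchoose n) * (- z) ^ n) sums (1 + (- z)) powr (- 1/2)"
    using assms by (intro gen_binomial_complex) simp
  moreover have "((- 1/2) gchoose n) * (- z) ^ n = of_real (inv_sqrt_coeff n) * z ^ n" for n
  proof -
    have "pochhammer (1/2 :: complex) n = of_real (pochhammer (1/2) n)"
      using pochhammer_of_real[of "1/2" n, where 'a=complex] by simp
    moreover have "(- 1 :: complex) ^ n * (- z) ^ n = z ^ n"
      by (simp flip: power_mult_distrib)
    ultimately show ?thesis
      by (simp add: gbinomial_pochhammer inv_sqrt_coeff_def mult.assoc)
  qed
  ultimately show ?thesis by simp
qed

abbreviation pot_coeff :: "nat \<Rightarrow> real"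
  where "pot_coeff n \<equiv> (inv_sqrt_coeff n)\<^sup>2"

lemma summable_pot_coeff: "\<bar>x\<bar> < 1 \<Longrightarrow> summable (\<lambda>n. pot_coeff n * x ^ n)"
proof (rule summable_comparison_test)
  assume "\<bar>x\<bar> < 1"
  then show "summable (\<lambda>n. \<bar>x\<bar> ^ n)" by (intro summable_geometric) simp
  have "pot_coeff n \<le> 1" for n
    using inv_sqrt_coeff_pos[of n] inv_sqrt_coeff_le_1[of n] by (simp add: power_le_one)
  then show "\<exists>N. \<forall>n\<ge>N. norm (pot_coeff n * x ^ n) \<le> \<bar>x\<bar> ^ n"
    by (auto simp: abs_mult power_abs intro!: mult_left_le_one_le)
qed

lemma summable_pot_coeff_linear:
  "\<bar>x\<bar> < 1 \<Longrightarrow> summable (\<lambda>n. (p + q * real n) * pot_coeff n * x ^ n)"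
  by (rule powser_linear_weight(1)) (rule summable_pot_coeff)

lemma summable_pot_coeff_quadratic:
  "\<bar>x\<bar> < 1 \<Longrightarrow> summable (\<lambda>n. (p' + q' * real n) * ((p + q * real n) * pot_coeff n) * x ^ n)"
  by (rule powser_linear_weight(1)) (rule summable_pot_coeff_linear)

lemma pot_coeff_Suc: "pot_coeff (Suc n) = pot_coeff n * ((2 * real n + 1)\<^sup>2 / (2 * real n + 2)\<^sup>2)"
  by (simp add: inv_sqrt_coeff_Suc power_mult_distrib power_divide)

text \<open>The sequence \<open>n a\<^sub>n\<close> starts at \<open>1/4\<close> and increases, since the ratio of consecutive terms is
  \<open>(2n + 1)\<^sup>2 / (4n (n + 1)) > 1\<close>.\<close>

lemma pot_coeff_ge: "n > 0 \<Longrightarrow> n * pot_coeff n \<ge> 1/4"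
proof (induction n rule: nat_induct_non_zero)
  case 1
  then show ?case using pot_coeff_Suc[of 0] by simp
next
  case (Suc n)
  define m where "m = real n"
  have m: "m > 0" using Suc.hyps by (simp add: m_def)
  have "m * (2 * m + 2)\<^sup>2 \<le> (m + 1) * (2 * m + 1)\<^sup>2"
    using m by (simp add: power2_eq_square algebra_simps)
  then have "m \<le> (m + 1) * ((2 * m + 1)\<^sup>2 / (2 * m + 2)\<^sup>2)"
    using m by (simp add: pos_le_divide_eq)
  from mult_right_mono[OF this, of "pot_coeff n"]
  have "n * pot_coeff n \<le> Suc n * pot_coeff (Suc n)"
    unfolding pot_coeff_Suc by (simp add: m_def mult_ac add_ac)
  then show ?case using Suc.IH by linarith
qed

text \<open>Since \<open>a\<^sub>n \<ge> 1 / (4n)\<close>, the series dominates a quarter of that of \<open>-ln (1 - x)\<close>.\<close>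

lemma powser_pot_coeff_ge_ln:
  assumes x: "0 \<le> x" "x < 1"
  shows "powser pot_coeff x \<ge> - ln (1 - x) / 4"
proof -
  have "(\<lambda>n. - (x ^ n) / real n) sums ln (1 - x)"
    using ln_series'[of "-x"] x by simp
  from sums_mult[OF this, of "-1/4"]
  have ln_sums: "(\<lambda>n. x ^ n / (4 * real n)) sums (- ln (1 - x) / 4)" by simp
  have "x ^ n / (4 * real n) \<le> pot_coeff n * x ^ n" for n
  proof (cases "n = 0")
    case False
    then have "1 / (4 * real n) \<le> pot_coeff n"
      using pot_coeff_ge[of n] by (simp add: field_simps)
    from mult_right_mono[OF this, of "x ^ n"] show ?thesis using x by simp
  qed simp
  then show ?thesis
    unfolding powser_def using x
    by (intro sums_le[OF _ ln_sums summable_sums] summable_pot_coeff) auto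
qed

section \<open>The potential as a power series\<close>

text \<open>Parseval's identity for trigonometric polynomials: the exponentials are orthonormal on the unit
  interval.\<close>

lemma integral_norm_square_trig_poly:
  fixes d :: "nat \<Rightarrow> real"
  shows "((\<lambda>t. (norm (\<Sum>n<N. of_real (d n) * cis (2 * pi * t) ^ n))\<^sup>2)
           has_integral (\<Sum>n<N. (d n)\<^sup>2)) {0..1}"
proof -
  have int: "((\<lambda>t. cos (2 * pi * (real m - real n) * t)) has_integral (if m = n then 1 else 0)) {0..1}"
    for m n :: nat
  proof (cases "m = n")
    case True
    then show ?thesis using has_integral_const_real[of "1::real" 0 1] by simp
  next
    case False
    define w where "w = 2 * pi * (real m - real n)"
    have w: "w \<noteq> 0" using False by (simp add: w_def)
    have sin_w: "sin w = 0"
      using sin_times_pi_eq_0[of "2 * (real m - real n)"] by (simp add: w_def mult_ac)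
    have "((\<lambda>t. cos (w * t)) has_integral (sin (w * 1) / w - sin (w * 0) / w)) {0..1}"
      using w by (intro fundamental_theorem_of_calculus)
        (auto intro!: derivative_eq_intros simp flip: has_real_derivative_iff_has_vector_derivative)
    then show ?thesis using False sin_w by (simp add: w_def)
  qed
  have expand: "(norm (\<Sum>n<N. of_real (d n) * cis (2 * pi * t) ^ n))\<^sup>2 =
      (\<Sum>m<N. \<Sum>n<N. d m * d n * cos (2 * pi * (real m - real n) * t))" for t
  proof -
    have "(norm (\<Sum>n<N. of_real (d n) * cis (2 * pi * t) ^ n))\<^sup>2 =
        (\<Sum>n<N. d n * cos (n * (2 * pi * t)))\<^sup>2 + (\<Sum>n<N. d n * sin (n * (2 * pi * t)))\<^sup>2"
      by (simp add: cmod_power2 Complex.DeMoivre)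
    also have "\<dots> = (\<Sum>m<N. \<Sum>n<N. d m * d n * cos (m * (2 * pi * t) - n * (2 * pi * t)))"
      by (simp add: power2_eq_square sum_product cos_diff algebra_simps sum.distrib)
    finally show ?thesis by (simp add: algebra_simps)
  qed
  have "((\<lambda>t. \<Sum>m<N. \<Sum>n<N. d m * d n * cos (2 * pi * (real m - real n) * t)) has_integral
      (\<Sum>m<N. \<Sum>n<N. d m * d n * (if m = n then 1 else 0))) {0..1}"
    by (intro has_integral_sum has_integral_mult_right int) auto
  moreover have "(\<Sum>m<N. \<Sum>n<N. d m * d n * (if m = n then 1 else 0)) = (\<Sum>n<N. (d n)\<^sup>2)"
    by (simp add: power2_eq_square if_distrib cong: if_cong)
  ultimately show ?thesis by (simp add: expand)
qed

text \<open>The integrand is the squared modulus of \<open>(1 - z)\<^sup>-\<^sup>1\<^sup>/\<^sup>2\<close> at \<open>z = x e\<^sup>2\<^sup>\<pi>\<^sup>i\<^sup>t\<close>. Parseval's identity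
  integrates the squared moduli of the Taylor polynomials, and these converge boundedly because
  the coefficients are at most 1 and \<open>x < 1\<close>.\<close>

lemma integral_inverse_distance:
  assumes x: "0 \<le> x" "x < 1"
  shows "integral {0..1} (\<lambda>t. 1 / sqrt (1 + x\<^sup>2 - 2 * x * cos (2 * pi * t))) =
    powser (\<lambda>n. (inv_sqrt_coeff n)\<^sup>2) (x\<^sup>2)"
proof -
  define S where "S N t = (\<Sum>n<N. of_real (inv_sqrt_coeff n * x ^ n) * cis (2 * pi * t) ^ n)" for N t
  have norm_z: "norm (of_real x * cis (2 * pi * t)) = x" for t
    using x by (simp add: norm_mult)
  have S_lim: "(\<lambda>N. (norm (S N t))\<^sup>2) \<longlonglongrightarrow> 1 / sqrt (1 + x\<^sup>2 - 2 * x * cos (2 * pi * t))" for t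
  proof -
    define z where "z = of_real x * cis (2 * pi * t)"
    have "(\<lambda>N. S N t) \<longlonglongrightarrow> (1 - z) powr (- 1/2)"
      using inv_sqrt_coeff_sums[of z] norm_z[of t] x
      by (simp add: sums_def S_def z_def power_mult_distrib mult_ac)
    then have "(\<lambda>N. (norm (S N t))\<^sup>2) \<longlonglongrightarrow> (norm ((1 - z) powr (- 1/2)))\<^sup>2"
      by (intro tendsto_intros)
    moreover have "1 - z \<noteq> 0"
      using norm_z[of t] x by (auto simp: z_def)
    then have "(norm ((1 - z) powr (- 1/2)))\<^sup>2 = 1 / norm (1 - z)"
      by (subst norm_powr_real_powr') (auto simp: power2_eq_square powr_minus_divide simp flip: powr_add)
    moreover have "norm (1 - z) = sqrt (1 + x\<^sup>2 - 2 * x * cos (2 * pi * t))"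
    proof -
      have "(1 - x * cos s)\<^sup>2 + (x * sin s)\<^sup>2 = 1 + x\<^sup>2 * ((sin s)\<^sup>2 + (cos s)\<^sup>2) - 2 * x * cos s" for s
        by algebra
      then show ?thesis by (simp add: z_def cmod_def)
    qed
    ultimately show ?thesis by simp
  qed
  have S_int: "((\<lambda>t. (norm (S N t))\<^sup>2) has_integral (\<Sum>n<N. (inv_sqrt_coeff n)\<^sup>2 * (x\<^sup>2) ^ n)) {0..1}" for N
    using integral_norm_square_trig_poly[where d="\<lambda>n. inv_sqrt_coeff n * x ^ n" and N=N]
    by (simp add: S_def power_mult_distrib power_mult[symmetric] mult.commute)
  have S_bound: "norm ((norm (S N t))\<^sup>2) \<le> (1 / (1 - x))\<^sup>2" for N t
  proof -
    have "norm (S N t) \<le> (\<Sum>n<N. norm (of_real (inv_sqrt_coeff n * x ^ n) * cis (2 * pi * t) ^ n))"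
      unfolding S_def by (rule norm_sum)
    also have "\<dots> \<le> (\<Sum>n<N. x ^ n)"
      using x inv_sqrt_coeff_pos inv_sqrt_coeff_le_1
      by (intro sum_mono) (auto simp: norm_mult norm_power abs_mult less_imp_le intro: mult_left_le_one_le)
    also have "\<dots> \<le> (\<Sum>n. x ^ n)"
      using x by (intro sum_le_suminf summable_geometric) auto
    also have "\<dots> = 1 / (1 - x)"
      using x by (intro suminf_geometric) auto
    finally show ?thesis by (simp add: power_mono)
  qed
  have "(\<lambda>N. integral {0..1} (\<lambda>t. (norm (S N t))\<^sup>2)) \<longlonglongrightarrow>
      integral {0..1} (\<lambda>t. 1 / sqrt (1 + x\<^sup>2 - 2 * x * cos (2 * pi * t)))"
    using S_int S_lim S_bound
    by (intro dominated_convergence(2)[where h="\<lambda>_. (1 / (1 - x))\<^sup>2"]) (auto intro: has_integral_integrable)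
  then have "(\<lambda>n. (inv_sqrt_coeff n)\<^sup>2 * (x\<^sup>2) ^ n) sums
      integral {0..1} (\<lambda>t. 1 / sqrt (1 + x\<^sup>2 - 2 * x * cos (2 * pi * t)))"
    using integral_unique[OF S_int] by (simp add: sums_def)
  then show ?thesis by (simp add: powser_def sums_iff)
qed

text \<open>By reflection in the circle, the distance of a point \<open>u\<close> of the circle from the point at radius
  \<open>r\<close> is \<open>r\<close> times its distance from the point at radius \<open>1/r\<close> on the same ray.\<close>

lemma radial_potential_eq:
  assumes r: "r > 1"
  shows "radial_potential lam r = - (2 * pi * lam / r) * powser (\<lambda>n. (inv_sqrt_coeff n)\<^sup>2) (1 / r\<^sup>2)"
proof -
  have "lam / norm (r *\<^sub>R axis 1 1 - circle_path t) * (2 * pi) =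
      (2 * pi * lam / r) * (1 / sqrt (1 + (1/r)\<^sup>2 - 2 * (1/r) * cos (2 * pi * t)))" for t
  proof -
    have "(r - cos s)\<^sup>2 + (sin s)\<^sup>2 = r\<^sup>2 * (1 + (1/r)\<^sup>2 - 2 * (1/r) * cos s)" for s
      using r sin_cos_squared_add[of s] by (simp add: field_simps power2_eq_square)
    then have "norm (r *\<^sub>R axis 1 1 - circle_path t) =
        r * sqrt (1 + (1/r)\<^sup>2 - 2 * (1/r) * cos (2 * pi * t))"
      using r by (simp add: norm_vec3 circle_path_def axis_def real_sqrt_mult)
    then show ?thesis by simp
  qed
  then have "radial_potential lam r = - integral {0..1}
      (\<lambda>t. (2 * pi * lam / r) * (1 / sqrt (1 + (1/r)\<^sup>2 - 2 * (1/r) * cos (2 * pi * t))))"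
    by (simp only: radial_potential_def circle_potential_def arclength_integral_circle)
  also have "\<dots> = - ((2 * pi * lam / r) * powser (\<lambda>n. (inv_sqrt_coeff n)\<^sup>2) ((1/r)\<^sup>2))"
    using integral_inverse_distance[of "1/r"] r by (simp only: integral_mult_right) simp
  finally show ?thesis by (simp add: power_divide)
qed

section \<open>The derivatives of the potentials\<close>

text \<open>The coefficients \<open>(4n\<^sup>2 - 1) a\<^sub>n\<close> of the series \<open>B\<close> with \<open>G'(r) = -2 \<pi> \<lambda> B(1 / r\<^sup>2)\<close>.\<close>

definition moment_deriv_coeff :: "nat \<Rightarrow> real"
  where "moment_deriv_coeff n = (2 * real n - 1) * ((2 * real n + 1) * pot_coeff n)"

lemma summable_moment_deriv_coeff:
  "\<bar>x\<bar> < 1 \<Longrightarrow> summable (\<lambda>n. moment_deriv_coeff n * x ^ n)"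
  using summable_pot_coeff_quadratic[of x "-1" 2 1 2] by (simp add: moment_deriv_coeff_def algebra_simps)

text \<open>The function \<open>G(r) = r\<^sup>3 V'(r)\<close>, written as a series.\<close>

definition moment :: "real \<Rightarrow> real \<Rightarrow> real"
  where "moment lam r = 2 * pi * lam * r * powser (\<lambda>n. (1 + 2 * real n) * pot_coeff n) (1 / r\<^sup>2)"

lemma radial_potential_deriv:
  assumes r: "r > 1"
  shows "(radial_potential lam has_real_derivative moment lam r / r ^ 3) (at r)"
proof -
  let ?Q = "powser (\<lambda>n. (1 + 2 * real n) * pot_coeff n) (1 / r\<^sup>2)"
  have "powser (\<lambda>n. (of_int (-1) - 2 * real n) * pot_coeff n) (1 / r\<^sup>2) = - ?Q"
    using summable_pot_coeff_linear[of "1 / r\<^sup>2" 1 2] r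
    by (simp add: powser_def algebra_simps flip: suminf_minus)
  then have "((\<lambda>r. - (2 * pi * lam) * (r powi (-1) * powser pot_coeff (1 / r\<^sup>2))) has_real_derivative
      - (2 * pi * lam) * (r powi (-2) * (- ?Q))) (at r)"
    using DERIV_cmult[OF DERIV_powi_mult_powser[OF summable_pot_coeff r], of "- (2 * pi * lam)" "-1"] by simp
  also have "- (2 * pi * lam) * (r powi (-2) * (- ?Q)) = moment lam r / r ^ 3"
    using r by (simp add: moment_def power_int_minus field_simps eval_nat_numeral)
  finally show ?thesis
  proof (rule has_field_derivative_transform_within_open[where S="{1<..}"])
    fix s :: real assume "s \<in> {1<..}"
    then show "- (2 * pi * lam) * (s powi - 1 * powser pot_coeff (1 / s\<^sup>2)) = radial_potential lam s"
      by (simp add: radial_potential_eq power_int_minus field_simps)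
  qed (use r in auto)
qed

text \<open>This is what reduces the critical points of \<open>U\<close> to the level sets of \<open>moment lam\<close>.\<close>

lemma effective_potential_deriv:
  assumes r: "r > 1"
  shows "(effective_potential lam K has_real_derivative (moment lam r - K\<^sup>2) / r ^ 3) (at r)"
proof -
  have "((\<lambda>r. K\<^sup>2 / (2 * r\<^sup>2)) has_real_derivative - K\<^sup>2 / r ^ 3) (at r)"
    using r by (auto intro!: derivative_eq_intros simp: field_simps eval_nat_numeral)
  from DERIV_add[OF this radial_potential_deriv[OF r]] show ?thesis
    unfolding effective_potential_def[abs_def] by (simp add: diff_divide_distrib)
qed

lemma moment_deriv:
  assumes r: "r > 1"
  shows "(moment lam has_real_derivative - (2 * pi * lam * powser moment_deriv_coeff (1 / r\<^sup>2))) (at r)"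
proof -
  let ?q = "\<lambda>n. (1 + 2 * real n) * pot_coeff n"
  have "((\<lambda>r. 2 * pi * lam * (r powi 1 * powser ?q (1 / r\<^sup>2))) has_real_derivative
      2 * pi * lam * (r powi (1 - 1) * powser (\<lambda>n. (of_int 1 - 2 * real n) * ?q n) (1 / r\<^sup>2))) (at r)"
    by (intro DERIV_cmult DERIV_powi_mult_powser r summable_pot_coeff_linear)
  moreover have "powser (\<lambda>n. (of_int 1 - 2 * real n) * ?q n) (1 / r\<^sup>2) =
      - powser moment_deriv_coeff (1 / r\<^sup>2)"
    using summable_moment_deriv_coeff[of "1 / r\<^sup>2"] r
    by (simp add: powser_def moment_deriv_coeff_def algebra_simps flip: suminf_minus)
  ultimately show ?thesis
    by (simp add: moment_def[abs_def] mult.assoc)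
qed

lemma continuous_on_moment: "continuous_on {1<..} (moment lam)"
  by (auto intro!: continuous_at_imp_continuous_on DERIV_isCont[OF moment_deriv])

section \<open>Limits of the potentials\<close>

lemma radial_potential_tendsto_0: "(radial_potential lam \<longlongrightarrow> 0) at_top"
proof -
  have "((\<lambda>r::real. - (2 * pi * lam / r)) \<longlongrightarrow> 0) at_top" by real_asymp
  from tendsto_mult[OF this tendsto_powser_at_top[OF summable_pot_coeff]]
  have "((\<lambda>r. - (2 * pi * lam / r) * powser pot_coeff (1 / r\<^sup>2)) \<longlongrightarrow> 0) at_top" by simp
  moreover have "eventually (\<lambda>r. - (2 * pi * lam / r) * powser pot_coeff (1 / r\<^sup>2) = radial_potential lam r) at_top"
    using eventually_gt_at_top[of 1] by eventually_elim (simp add: radial_potential_eq)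
  ultimately show ?thesis by (rule Lim_transform_eventually)
qed

lemma effective_potential_tendsto_0: "(effective_potential lam K \<longlongrightarrow> 0) at_top"
proof -
  have "((\<lambda>r::real. K\<^sup>2 / (2 * r\<^sup>2)) \<longlongrightarrow> 0) at_top" by real_asymp
  from tendsto_add[OF this radial_potential_tendsto_0] show ?thesis
    by (simp add: effective_potential_def[abs_def])
qed

text \<open>The potential is at most a positive multiple of \<open>ln (1 - 1 / r\<^sup>2)\<close> over \<open>r\<close>, while the
  centrifugal term stays bounded.\<close>

lemma effective_potential_at_bot:
  assumes lam: "lam > 0"
  shows "filterlim (effective_potential lam K) at_bot (at_right 1)"
proof -
  define C where "C = pi * lam / 2"
  have "C > 0" using lam by (simp add: C_def)
  then have "filterlim (\<lambda>r. K\<^sup>2 / (2 * r\<^sup>2) + C / r * ln (1 - 1 / r\<^sup>2)) at_bot (at_right 1)"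
    by real_asymp
  moreover have "eventually (\<lambda>r. effective_potential lam K r \<le>
      K\<^sup>2 / (2 * r\<^sup>2) + C / r * ln (1 - 1 / r\<^sup>2)) (at_right 1)"
    using eventually_at_right_less[of 1]
  proof eventually_elim
    case (elim r)
    have "(2 * pi * lam / r) * (- ln (1 - 1 / r\<^sup>2) / 4) \<le> (2 * pi * lam / r) * powser pot_coeff (1 / r\<^sup>2)"
      using elim lam by (intro mult_left_mono powser_pot_coeff_ge_ln) auto
    then show ?case
      using elim by (simp add: effective_potential_def radial_potential_eq C_def)
  qed
  ultimately show ?thesis by (rule filterlim_at_bot_mono)
qed

section \<open>Growth of the moment function\<close>

lemma powser_moment_ge:
  assumes "r > 1"
  shows "powser (\<lambda>n. (1 + 2 * real n) * pot_coeff n) (1 / r\<^sup>2) \<ge> 1 / (4 * (1 - 1 / r\<^sup>2)) - 5/4"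
proof (rule powser_ge_geometric)
  fix n :: nat assume "n > 0"
  moreover have "n * pot_coeff n \<le> (1 + 2 * real n) * pot_coeff n"
    by (intro mult_right_mono) auto
  ultimately show "1/4 \<le> (1 + 2 * real n) * pot_coeff n" using pot_coeff_ge[of n] by linarith
qed (use assms summable_pot_coeff_linear in auto)

lemma moment_ge:
  assumes lam: "lam > 0" and r: "r > 1"
  shows "moment lam r \<ge> 2 * pi * lam * r"
proof -
  let ?q = "\<lambda>n. (1 + 2 * real n) * pot_coeff n"
  have "sum (\<lambda>n. ?q n * (1 / r\<^sup>2) ^ n) {0} \<le> powser ?q (1 / r\<^sup>2)"
    unfolding powser_def using r by (intro sum_le_suminf summable_pot_coeff_linear) auto
  then have "2 * pi * lam * r * 1 \<le> 2 * pi * lam * r * powser ?q (1 / r\<^sup>2)"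
    using lam r by (intro mult_left_mono) auto
  then show ?thesis by (simp add: moment_def)
qed

lemma moment_at_right_1:
  assumes lam: "lam > 0"
  shows "filterlim (moment lam) at_top (at_right 1)"
proof -
  define C where "C = 2 * pi * lam"
  have C: "C > 0" using lam by (simp add: C_def)
  then have "filterlim (\<lambda>r. C * r * (1 / (4 * (1 - 1 / r\<^sup>2)) - 5/4)) at_top (at_right 1)"
    by real_asymp
  moreover have "eventually (\<lambda>r. C * r * (1 / (4 * (1 - 1 / r\<^sup>2)) - 5/4) \<le> moment lam r) (at_right 1)"
    using eventually_at_right_less[of 1]
  proof eventually_elim
    case (elim r)
    then show ?case
      unfolding moment_def C_def[symmetric] using C by (intro mult_left_mono powser_moment_ge) auto
  qed
  ultimately show ?thesis by (rule filterlim_at_top_mono)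
qed

lemma moment_at_top:
  assumes lam: "lam > 0"
  shows "filterlim (moment lam) at_top at_top"
proof -
  have "filterlim (\<lambda>r. 2 * pi * lam * r) at_top at_top" using lam by real_asymp
  moreover have "eventually (\<lambda>r. 2 * pi * lam * r \<le> moment lam r) at_top"
    using eventually_gt_at_top[of 1] by eventually_elim (rule moment_ge[OF lam])
  ultimately show ?thesis by (rule filterlim_at_top_mono)
qed

section \<open>The minimum of the moment function\<close>

lemma moment_deriv_coeff_pos: "n > 0 \<Longrightarrow> moment_deriv_coeff n > 0"
  using inv_sqrt_coeff_pos[of n] by (simp add: moment_deriv_coeff_def)

text \<open>The ratio of consecutive coefficients, \<open>(2n + 3) (2n + 1)\<^sup>2 / ((2n - 1) (2n + 2)\<^sup>2)\<close>, is at most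
  3 for \<open>n \<ge> 1\<close>. Any bound below 4 on the growth makes a geometric series dominate the one at \<open>1/4\<close>.\<close>

lemma moment_deriv_coeff_Suc_le: "moment_deriv_coeff (Suc n) \<le> 3 ^ Suc n / 4"
proof (induction n)
  case 0
  show ?case using pot_coeff_Suc[of 0] by (simp add: moment_deriv_coeff_def)
next
  case (Suc n)
  define m where "m = real n"
  have m: "m \<ge> 0" by (simp add: m_def)
  have "(2 * m + 5) * (2 * m + 3)\<^sup>2 \<le> 3 * ((2 * m + 1) * (2 * m + 4)\<^sup>2)"
    using m by (simp add: power2_eq_square algebra_simps)
  then have "(2 * m + 5) * ((2 * m + 3)\<^sup>2 / (2 * m + 4)\<^sup>2) \<le> 3 * (2 * m + 1)"
    using m by (simp add: field_simps)
  then have "(2 * m + 3) * pot_coeff (Suc n) * ((2 * m + 5) * ((2 * m + 3)\<^sup>2 / (2 * m + 4)\<^sup>2)) \<le>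
      (2 * m + 3) * pot_coeff (Suc n) * (3 * (2 * m + 1))"
    using m by (intro mult_left_mono) auto
  then have "moment_deriv_coeff (Suc (Suc n)) \<le> 3 * moment_deriv_coeff (Suc n)"
    unfolding moment_deriv_coeff_def pot_coeff_Suc[of "Suc n"] by (simp add: m_def algebra_simps)
  then show ?case using Suc by simp
qed

text \<open>At \<open>1/4\<close> the positive part of the series is at most \<open>3/4\<close>, not enough to outweigh the constant
  term \<open>-1\<close>; at \<open>3/4\<close> the first three terms already have a positive sum. The lower bound \<open>1/4\<close>
  is what places the minimum of \<open>G\<close> below \<open>r = 2\<close>.\<close>

lemma ex_zero_moment_deriv:
  obtains x0 where "1/4 < x0" "x0 < 1" "powser moment_deriv_coeff x0 = 0"
proof -
  let ?b = moment_deriv_coeff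
  note summ = summable_moment_deriv_coeff
  have b0: "?b 0 = -1" and b1: "?b 1 = 3/4" and b2: "?b 2 = 135/64"
    using pot_coeff_Suc[of 0] pot_coeff_Suc[of 1]
    by (simp_all add: moment_deriv_coeff_def numeral_2_eq_2)
  have "(\<lambda>n. 3/16 * (3/4) ^ n) sums (3/16 * (1 / (1 - 3/4 :: real)))"
    by (intro sums_mult geometric_sums) simp
  \<comment> \<open>The terms after the constant one shrink at least like powers of \<open>3 \<cdot> 1/4\<close>.\<close>
  moreover have le: "?b (Suc n) * (1/4) ^ Suc n \<le> 3/16 * (3/4) ^ n" for n
    using mult_right_mono[OF moment_deriv_coeff_Suc_le[of n], of "(1/4) ^ Suc n"]
    by (simp add: power_divide)
  moreover have "(\<lambda>n. ?b n * (1/4) ^ n) sums powser ?b (1/4)"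
    unfolding powser_def by (intro summable_sums summ) simp
  then have "(\<lambda>n. ?b (Suc n) * (1/4) ^ Suc n) sums (powser ?b (1/4) - ?b 0)"
    by (subst sums_Suc_iff) simp
  ultimately have "powser ?b (1/4) - ?b 0 \<le> 3/16 * (1 / (1 - 3/4))"
    by (intro sums_le[OF le])
  then have neg: "powser ?b (1/4) < 0" by (simp add: b0)
  have "(\<Sum>n<3. ?b n * (3/4) ^ n) \<le> powser ?b (3/4)"
    unfolding powser_def
  proof (intro sum_le_suminf summ)
    fix n :: nat assume "n \<in> - {..<3}"
    then show "0 \<le> ?b n * (3/4) ^ n" using moment_deriv_coeff_pos[of n] by simp
  qed auto
  then have pos: "powser ?b (3/4) > 0"
    using b0 b1 b2 by (simp add: eval_nat_numeral)
  have "continuous_on {1/4..3/4} (powser ?b)"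
    by (intro continuous_on_powser summ) auto
  with neg pos obtain x0 where "1/4 \<le> x0" "x0 \<le> 3/4" "powser ?b x0 = 0"
    using IVT'[of "powser ?b" "1/4" 0 "3/4"] by auto
  moreover from this neg have "x0 \<noteq> 1/4" by (metis less_irrefl)
  ultimately show ?thesis by (intro that[of x0]) auto
qed

text \<open>The derivative of \<open>G\<close> has the sign of \<open>-B(1 / r\<^sup>2)\<close>, and \<open>1 / r\<^sup>2\<close> decreases in \<open>r\<close>, so \<open>G\<close> turns
  from decreasing to increasing where \<open>1 / r\<^sup>2\<close> passes the zero of \<open>B\<close>.\<close>

lemma moment_valley:
  assumes lam: "lam > 0"
  obtains r0 where "1 < r0" "r0 < 2"
    "strict_antimono_on {1<..r0} (moment lam)" "strict_mono_on {r0..} (moment lam)"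
proof -
  let ?B = "powser moment_deriv_coeff"
  obtain x0 where x0: "1/4 < x0" "x0 < 1" "?B x0 = 0" by (rule ex_zero_moment_deriv)
  define r0 where "r0 = 1 / sqrt x0"
  have r0_sq: "1 / r0\<^sup>2 = x0" using x0 by (simp add: r0_def power_divide)
  have "sqrt (1/4) < sqrt x0" "sqrt x0 < 1" using x0 by simp_all
  then have r0: "1 < r0" "r0 < 2" using x0 by (simp_all add: r0_def field_simps real_sqrt_divide)
  have mono: "?B x < ?B y" if "0 \<le> x" "x < y" "y < 1" for x y
    using that by (intro powser_strict_mono summable_moment_deriv_coeff moment_deriv_coeff_pos) auto
  have dec: "moment lam s < moment lam r" if "1 < r" "r < s" "s \<le> r0" for r s
  proof (rule DERIV_neg_imp_decreasing_open[OF that(2)])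
    fix t assume t: "r < t" "t < s"
    then have "x0 < 1 / t\<^sup>2" using that unfolding r0_sq[symmetric]
      by (intro divide_strict_left_mono power_strict_mono) auto
    with mono[of x0 "1 / t\<^sup>2"] x0 t that lam
    show "\<exists>y. (moment lam has_real_derivative y) (at t) \<and> y < 0"
      by (intro exI[of _ "- (2 * pi * lam * ?B (1 / t\<^sup>2))"] conjI moment_deriv) auto
  qed (use that in \<open>auto intro: continuous_on_subset[OF continuous_on_moment]\<close>)
  have inc: "moment lam r < moment lam s" if "r0 \<le> r" "r < s" for r s
  proof (rule DERIV_pos_imp_increasing_open[OF that(2)])
    fix t assume t: "r < t" "t < s"
    then have "1 / t\<^sup>2 < x0" using that r0 unfolding r0_sq[symmetric]
      by (intro divide_strict_left_mono power_strict_mono) auto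
    with mono[of "1 / t\<^sup>2" x0] x0 t that r0 lam
    show "\<exists>y. (moment lam has_real_derivative y) (at t) \<and> y > 0"
      by (intro exI[of _ "- (2 * pi * lam * ?B (1 / t\<^sup>2))"] conjI moment_deriv)
         (auto simp: mult_pos_neg)
  qed (use that r0 in \<open>auto intro: continuous_on_subset[OF continuous_on_moment]\<close>)
  from that[OF r0] dec inc show ?thesis
    by (auto simp: monotone_on_def)
qed

section \<open>Values at critical points\<close>

text \<open>The value of \<open>U\<close> at a critical point \<open>r\<close>, where \<open>K\<^sup>2\<close> may be replaced by \<open>moment lam r\<close>; no
  dependence on \<open>K\<close> is left.\<close>

definition critical_value :: "real \<Rightarrow> real \<Rightarrow> real"
  where "critical_value lam r = moment lam r / (2 * r\<^sup>2) + radial_potential lam r"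

text \<open>Both summands diverge, with opposite signs. Combining them into
  \<open>(\<pi> \<lambda> / r) \<Sum>n. (2n - 1) a\<^sub>n x\<^sup>n\<close> shows that the repulsive one wins: for \<open>n \<ge> 1\<close> the coefficients
  are at least \<open>n a\<^sub>n \<ge> 1/4\<close>.\<close>

lemma critical_value_at_right_1:
  assumes lam: "lam > 0"
  shows "filterlim (critical_value lam) at_top (at_right 1)"
proof -
  define C where "C = pi * lam"
  have C: "C > 0" using lam by (simp add: C_def)
  then have "filterlim (\<lambda>r. C / r * (1 / (4 * (1 - 1 / r\<^sup>2)) - 5/4)) at_top (at_right 1)"
    by real_asymp
  moreover have "eventually (\<lambda>r. C / r * (1 / (4 * (1 - 1 / r\<^sup>2)) - 5/4) \<le> critical_value lam r) (at_right 1)"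
    using eventually_at_right_less[of 1]
  proof eventually_elim
    case (elim r)
    define x where "x = 1 / r\<^sup>2"
    have x: "0 \<le> x" "x < 1" "\<bar>x\<bar> < 1" using elim by (auto simp: x_def)
    let ?e = "\<lambda>n. (-1 + 2 * real n) * pot_coeff n"
    define P where "P = powser pot_coeff x"
    define Q where "Q = powser (\<lambda>n. (1 + 2 * real n) * pot_coeff n) x"
    define E where "E = powser ?e x"
    have Q_eq: "Q = E + 2 * P"
      using powser_linear_weight(3)[OF summable_pot_coeff x(3), of "-1" 2]
        powser_linear_weight(3)[OF summable_pot_coeff x(3), of 1 2] by (simp add: P_def Q_def E_def)
    have "critical_value lam r = 2 * pi * lam * r * Q / (2 * r\<^sup>2) - 2 * pi * lam / r * P"
      using elim by (simp add: critical_value_def moment_def radial_potential_eq P_def Q_def x_def)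
    also have "\<dots> = C / r * E"
      using elim unfolding Q_eq by (simp add: C_def field_simps power2_eq_square)
    finally have "critical_value lam r = C / r * E" .
    moreover have "E \<ge> 1 / (4 * (1 - x)) - 5/4"
      unfolding E_def
    proof (rule powser_ge_geometric)
      fix n :: nat assume "n > 0"
      moreover from this have "n * pot_coeff n \<le> (-1 + 2 * real n) * pot_coeff n"
        by (intro mult_right_mono) auto
      ultimately show "1/4 \<le> (-1 + 2 * real n) * pot_coeff n" using pot_coeff_ge[of n] by linarith
    qed (use x summable_pot_coeff_linear[of _ "-1" 2] in auto)
    ultimately show ?case
      using C elim by (auto simp: x_def intro!: mult_left_mono divide_right_mono)
  qed
  ultimately show ?thesis by (rule filterlim_at_top_mono)
qed

lemma critical_value_tendsto_0: "(critical_value lam \<longlongrightarrow> 0) at_top"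
proof -
  have "((\<lambda>r::real. pi * lam / r) \<longlongrightarrow> 0) at_top" by real_asymp
  from tendsto_add[OF tendsto_mult[OF this tendsto_powser_at_top[OF summable_pot_coeff_linear[of _ 1 2]]]
      radial_potential_tendsto_0[of lam]]
  have "((\<lambda>r. pi * lam / r * powser (\<lambda>n. (1 + 2 * real n) * pot_coeff n) (1 / r\<^sup>2) +
      radial_potential lam r) \<longlongrightarrow> 0) at_top" by simp
  moreover have "eventually (\<lambda>r. pi * lam / r * powser (\<lambda>n. (1 + 2 * real n) * pot_coeff n) (1 / r\<^sup>2) +
      radial_potential lam r = critical_value lam r) at_top"
    using eventually_gt_at_top[of 1]
    by eventually_elim (simp add: critical_value_def moment_def field_simps power2_eq_square)
  ultimately show ?thesis by (rule Lim_transform_eventually)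
qed

section \<open>Level sets of a function with one minimum\<close>

text \<open>Continuity of the inverse up to the endpoint comes from extending it by a line of slope 1 to the
  left of \<open>h a\<close>: the extension is monotone and onto the whole line, hence continuous.\<close>

lemma strict_mono_inverse_branch:
  fixes h :: "real \<Rightarrow> real"
  assumes cont: "continuous_on {a..} h" and mono: "strict_mono_on {a..} h"
    and lim: "filterlim h at_top at_top"
  obtains g where "continuous_on {h a..} g" "strict_mono_on {h a..} g" "g (h a) = a"
    "\<And>k. k \<ge> h a \<Longrightarrow> a \<le> g k \<and> h (g k) = k" "filterlim g at_top at_top"
proof -
  define g where "g = inv_into {a..} h"
  have inj: "inj_on h {a..}" using mono by (rule strict_mono_on_imp_inj_on)
  have surj: "k \<in> h ` {a..}" if k: "k \<ge> h a" for k
  proof -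
    have "eventually (\<lambda>s. s \<ge> a \<and> h s \<ge> k) at_top"
      using lim by (intro eventually_conj eventually_ge_at_top) (simp add: filterlim_at_top)
    then obtain b where b: "b \<ge> a" "h b \<ge> k" by (auto simp: eventually_at_top_linorder)
    then obtain s where "a \<le> s" "s \<le> b" "h s = k"
      using IVT'[of h a k b] k continuous_on_subset[OF cont, of "{a..b}"] by auto
    then show ?thesis by auto
  qed
  have g: "a \<le> g k \<and> h (g k) = k" if "k \<ge> h a" for k
    using inv_into_into[OF surj[OF that]] f_inv_into_f[OF surj[OF that]] by (simp add: g_def)
  have g_h: "g (h s) = s" if "s \<ge> a" for s
    using that inj by (simp add: g_def)
  have h_le: "h a \<le> h s" if "s \<ge> a" for s
    using strict_mono_onD[OF mono, of a s] that by (cases "s = a") auto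
  have g_mono: "g k < g l" if "h a \<le> k" "k < l" for k l
  proof (rule ccontr)
    assume "\<not> g k < g l"
    then have "h (g l) \<le> h (g k)"
      using strict_mono_onD[OF mono, of "g l" "g k"] g[of k] g[of l] that
      by (cases "g l = g k") auto
    with g[of k] g[of l] that show False by auto
  qed
  have "continuous_on {h a..} g"
  proof -
    \<comment> \<open>The linear extension of \<open>g\<close>, a monotone map onto the whole line.\<close>
    define e where "e k = (if k \<ge> h a then g k else a + (k - h a))" for k
    have "s \<in> range e" for s
    proof (cases "s \<ge> a")
      case True
      then have "s = e (h s)" using h_le g_h by (simp add: e_def)
      then show ?thesis by blast
    next
      case False
      then have "s = e (h a + (s - a))" by (simp add: e_def)
      then show ?thesis by blast
    qed
    then have "range e = UNIV" by blast
    moreover have "e k \<le> e l" if "k \<le> l" for k l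
    proof (cases "k < h a \<and> l \<ge> h a")
      case True
      then show ?thesis using g[of l] by (simp add: e_def)
    next
      case False
      then show ?thesis using that g_mono[of k l] by (cases "k = l") (auto simp: e_def)
    qed
    ultimately have "continuous_on UNIV e" by (intro continuous_onI_mono) auto
    then show ?thesis
      using continuous_on_cong[of "{h a..}" "{h a..}" g e] continuous_on_subset[of UNIV e "{h a..}"]
      by (simp add: e_def)
  qed
  moreover have "strict_mono_on {h a..} g"
    using g_mono by (intro strict_mono_onI) auto
  moreover have "filterlim g at_top at_top"
    unfolding filterlim_at_top
  proof
    fix Z
    define M where "M = max Z a"
    have "Z \<le> g k" if "k \<ge> h M" for k
      using that g_mono[of "h M" k] g_h[of M] h_le[of M] by (cases "k = h M") (auto simp: M_def)
    then show "eventually (\<lambda>k. Z \<le> g k) at_top"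
      by (auto simp: eventually_at_top_linorder)
  qed
  ultimately show ?thesis using that[of g] g g_h by auto
qed

text \<open>The right branch is the inverse of \<open>\<surd>G\<close> on \<open>[r0, \<infinity>)\<close>. The left branch reduces to the same
  situation through \<open>r = 1 + 1/s\<close>, which reverses the order and carries \<open>(1, r0]\<close> to a
  half-line with \<open>r = 1\<close> at infinity.\<close>

lemma valley_level_branches:
  fixes G :: "real \<Rightarrow> real"
  assumes r0: "1 < r0" and cont: "continuous_on {1<..} G" and pos: "\<And>r. r > 1 \<Longrightarrow> G r > 0"
    and dec: "strict_antimono_on {1<..r0} G" and inc: "strict_mono_on {r0..} G"
    and lim_1: "filterlim G at_top (at_right 1)" and lim_top: "filterlim G at_top at_top"
  obtains r1 r2 where
    "continuous_on {sqrt (G r0)..} r1" "continuous_on {sqrt (G r0)..} r2"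
    "r1 (sqrt (G r0)) = r0" "r2 (sqrt (G r0)) = r0"
    "\<And>k. k \<ge> sqrt (G r0) \<Longrightarrow> 1 < r1 k \<and> r1 k \<le> r0 \<and> G (r1 k) = k\<^sup>2"
    "\<And>k. k \<ge> sqrt (G r0) \<Longrightarrow> r0 \<le> r2 k \<and> G (r2 k) = k\<^sup>2"
    "strict_antimono_on {sqrt (G r0)..} r1" "filterlim r1 (at_right 1) at_top"
    "strict_mono_on {sqrt (G r0)..} r2" "filterlim r2 at_top at_top"
proof -
  let ?K = "sqrt (G r0)"
  have K_pos: "?K > 0" using pos r0 by simp
  have level: "x = k\<^sup>2" if "sqrt x = k" "k \<ge> ?K" for x k
  proof -
    have "x \<ge> 0" using that K_pos by (metis less_le_trans not_less order.strict_iff_order real_sqrt_gt_0_iff)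
    with that show ?thesis by auto
  qed
  have "continuous_on {r0..} (\<lambda>r. sqrt (G r))"
    using r0 by (intro continuous_intros continuous_on_subset[OF cont]) auto
  moreover have "strict_mono_on {r0..} (\<lambda>r. sqrt (G r))"
    using inc by (auto simp: monotone_on_def)
  moreover have "filterlim (\<lambda>r. sqrt (G r)) at_top at_top"
    by (rule filterlim_compose[OF sqrt_at_top lim_top])
  ultimately obtain r2 where r2: "continuous_on {?K..} r2" "strict_mono_on {?K..} r2" "r2 ?K = r0"
      "\<And>k. k \<ge> ?K \<Longrightarrow> r0 \<le> r2 k \<and> sqrt (G (r2 k)) = k" "filterlim r2 at_top at_top"
    by (rule strict_mono_inverse_branch) auto
  \<comment> \<open>The value of \<open>s\<close> with \<open>1 + 1/s = r0\<close>.\<close>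
  define a where "a = 1 / (r0 - 1)"
  have a: "a > 0" "1 + 1 / a = r0" using r0 by (simp_all add: a_def)
  have into: "1 < 1 + 1 / s" "1 + 1 / s \<le> r0" if "s \<ge> a" for s
    using that a frac_le[of 1 1 a s] by auto
  have "continuous_on {a..} (\<lambda>s. sqrt (G (1 + 1 / s)))"
    using a into by (intro continuous_intros continuous_on_compose2[OF cont]) auto
  moreover have "strict_mono_on {a..} (\<lambda>s. sqrt (G (1 + 1 / s)))"
  proof (rule strict_mono_onI)
    fix s t assume st: "s \<in> {a..}" "t \<in> {a..}" "s < t"
    then have "1 + 1 / t < 1 + 1 / s" using a by (simp add: frac_less2)
    then show "sqrt (G (1 + 1 / s)) < sqrt (G (1 + 1 / t))"
      using st into monotone_onD[OF dec, of "1 + 1 / t" "1 + 1 / s"] by auto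
  qed
  moreover have "filterlim (\<lambda>s. sqrt (G (1 + 1 / s))) at_top at_top"
  proof -
    have "filterlim (\<lambda>s::real. 1 + 1 / s) (at_right 1) at_top" by real_asymp
    from filterlim_compose[OF sqrt_at_top filterlim_compose[OF lim_1 this]] show ?thesis .
  qed
  ultimately obtain g where g: "continuous_on {?K..} g" "strict_mono_on {?K..} g" "g ?K = a"
      "\<And>k. k \<ge> ?K \<Longrightarrow> a \<le> g k \<and> sqrt (G (1 + 1 / g k)) = k" "filterlim g at_top at_top"
    using strict_mono_inverse_branch[of a "\<lambda>s. sqrt (G (1 + 1 / s))"] a(2) by metis
  define r1 where "r1 k = 1 + 1 / g k" for k
  have g_pos: "g k > 0" if "k \<ge> ?K" for k using g(4)[OF that] a by linarith
  show ?thesis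
  proof (rule that[of r1 r2])
    show "continuous_on {?K..} r1"
      unfolding r1_def using g_pos by (intro continuous_intros g(1)) force
    show "r1 ?K = r0" using g(3) a by (simp add: r1_def)
    show "1 < r1 k \<and> r1 k \<le> r0 \<and> G (r1 k) = k\<^sup>2" if "k \<ge> ?K" for k
      using g(4)[OF that] into[of "g k"] level[of _ k] that unfolding r1_def by blast
    show "r0 \<le> r2 k \<and> G (r2 k) = k\<^sup>2" if "k \<ge> ?K" for k
      using r2(4)[OF that] level that by blast
    show "strict_antimono_on {?K..} r1"
    proof (rule monotone_onI)
      fix k l assume kl: "k \<in> {?K..}" "l \<in> {?K..}" "k < l"
      then have "g k < g l" using strict_mono_onD[OF g(2)] by blast
      then show "r1 l < r1 k" using g_pos[of k] kl by (simp add: r1_def frac_less2)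
    qed
    have "filterlim (\<lambda>s::real. 1 + 1 / s) (at_right 1) at_top" by real_asymp
    from filterlim_compose[OF this g(5)] show "filterlim r1 (at_right 1) at_top"
      unfolding r1_def .
  qed (use r2 in auto)
qed

section \<open>The effective potential of a circle\<close>

theorem theoremC:
  fixes lam :: real
  assumes "lam > 0"
  shows
    "(\<forall>r>1. radial_potential lam differentiable (at r) \<and> deriv (radial_potential lam) r > 0) \<and>
     (\<forall>K. \<forall>r>1. (\<lambda>s. effective_potential lam K s - K\<^sup>2 / (2 * s\<^sup>2)) differentiable (at r) \<and>
        deriv (\<lambda>s. effective_potential lam K s - K\<^sup>2 / (2 * s\<^sup>2)) r > 0) \<and>
     (\<forall>K. filterlim (effective_potential lam K) at_bot (at_right 1)) \<and>
     (\<forall>K. (effective_potential lam K \<longlongrightarrow> 0) at_top) \<and>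
     (\<exists>K0 r0. \<exists>r1 r2 :: real \<Rightarrow> real.
        0 < K0 \<and> 1 < r0 \<and> r0 < 2 \<and>
        continuous_on {K0..} r1 \<and> continuous_on {K0..} r2 \<and>
        (\<forall>k\<ge>K0. 1 < r1 k \<and> r1 k \<le> r0 \<and> r0 \<le> r2 k) \<and>
        (\<forall>K\<in>{-K0<..<K0}.
           (\<nexists>r. 1 < r \<and> critical_point (effective_potential lam K) r) \<and>
           (\<forall>r>1. effective_potential lam K differentiable (at r) \<and> deriv (effective_potential lam K) r > 0) \<and>
           strict_mono_on {1<..} (effective_potential lam K)) \<and>
        (\<forall>K. K \<notin> {-K0<..<K0} \<longrightarrow>
           {r. 1 < r \<and> critical_point (effective_potential lam K) r} = {r1 \<bar>K\<bar>, r2 \<bar>K\<bar>}) \<and>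
        (\<forall>K. K \<notin> {-K0<..<K0} \<longrightarrow>
           (\<forall>r>1. r < r1 \<bar>K\<bar> \<or> r2 \<bar>K\<bar> < r \<longrightarrow>
              effective_potential lam K differentiable (at r) \<and> deriv (effective_potential lam K) r > 0) \<and>
           (\<forall>r. r1 \<bar>K\<bar> < r \<and> r < r2 \<bar>K\<bar> \<longrightarrow>
              effective_potential lam K differentiable (at r) \<and> deriv (effective_potential lam K) r < 0)) \<and>
        r1 K0 = r0 \<and> r2 K0 = r0 \<and>
        strict_antimono_on {K0..} r1 \<and> (r1 \<longlongrightarrow> 1) at_top \<and>
        strict_mono_on {K0..} r2 \<and> filterlim r2 at_top at_top \<and>
        filterlim (\<lambda>K. effective_potential lam K (r1 K)) at_top at_top \<and>
        ((\<lambda>K. effective_potential lam K (r2 K)) \<longlongrightarrow> 0) at_top)"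
proof -
  let ?V = "radial_potential lam" and ?U = "effective_potential lam" and ?G = "moment lam"
  have G_pos: "?G r > 0" if "r > 1" for r
  proof -
    have "0 < 2 * pi * lam * r" using assms that by simp
    then show ?thesis using moment_ge[OF assms that] by linarith
  qed
  have V': "?V differentiable (at r) \<and> deriv ?V r > 0" if "r > 1" for r
    using radial_potential_deriv[OF that, of lam] G_pos[OF that] that
    by (auto simp: DERIV_imp_deriv real_differentiable_def)
  have U_minus: "(\<lambda>s. ?U K s - K\<^sup>2 / (2 * s\<^sup>2)) = ?V" for K
    by (simp add: effective_potential_def)
  obtain r0 where r0: "1 < r0" "r0 < 2"
      and dec: "strict_antimono_on {1<..r0} ?G" and inc: "strict_mono_on {r0..} ?G"
    using moment_valley[OF assms] by blast
  define K0 where "K0 = sqrt (?G r0)"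
  have K0: "K0 > 0" "K0\<^sup>2 = ?G r0" using G_pos[OF r0(1)] by (simp_all add: K0_def)
  obtain r1 r2 where
    r1_cont: "continuous_on {K0..} r1" and r2_cont: "continuous_on {K0..} r2"
    and r1_K0: "r1 K0 = r0" and r2_K0: "r2 K0 = r0"
    and r1: "\<And>k. k \<ge> K0 \<Longrightarrow> 1 < r1 k \<and> r1 k \<le> r0 \<and> ?G (r1 k) = k\<^sup>2"
    and r2: "\<And>k. k \<ge> K0 \<Longrightarrow> r0 \<le> r2 k \<and> ?G (r2 k) = k\<^sup>2"
    and r1_mono: "strict_antimono_on {K0..} r1" and r1_lim: "filterlim r1 (at_right 1) at_top"
    and r2_mono: "strict_mono_on {K0..} r2" and r2_lim: "filterlim r2 at_top at_top"
    unfolding K0_def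
    by (rule valley_level_branches[OF r0(1) continuous_on_moment G_pos dec inc
          moment_at_right_1[OF assms] moment_at_top[OF assms]]) blast+
  have G_less: "?G s < ?G r" if "1 < r" "r < s" "s \<le> r0" for r s
    using monotone_onD[OF dec, of r s] that by auto
  have less_G: "?G r < ?G s" if "r0 \<le> r" "r < s" for r s
    using monotone_onD[OF inc, of r s] that by auto
  have G_min: "?G r0 \<le> ?G r" if "1 < r" for r
    using G_less[of r r0] less_G[of r0 r] that by (cases r r0 rule: linorder_cases) auto
  have U': "?U K differentiable (at r)" "deriv (?U K) r = (?G r - K\<^sup>2) / r ^ 3"
      "critical_point (?U K) r \<longleftrightarrow> ?G r = K\<^sup>2" if "r > 1" for K r
    using effective_potential_deriv[OF that, of lam K] that
      DERIV_unique[OF effective_potential_deriv[OF that, of lam K], of 0]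
    by (auto simp: DERIV_imp_deriv real_differentiable_def critical_point_def)
  have outside: "?G r > k\<^sup>2" if "k \<ge> K0" "r > 1" "r < r1 k \<or> r2 k < r" for k r
    using that r1[OF that(1)] r2[OF that(1)] G_less[of r "r1 k"] less_G[of "r2 k" r] by auto
  have inside: "?G r < k\<^sup>2" if "k \<ge> K0" "r1 k < r" "r < r2 k" for k r
    using that r1[OF that(1)] r2[OF that(1)] G_less[of "r1 k" r] less_G[of r "r2 k"]
    by (cases "r \<le> r0") auto
  have small: "K\<^sup>2 < ?G r" if "K \<in> {-K0<..<K0}" "r > 1" for K r
  proof -
    have "\<bar>K\<bar>\<^sup>2 < K0\<^sup>2" using that K0(1) by (intro power_strict_mono) auto
    then show ?thesis using G_min[OF that(2)] K0(2) by simp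
  qed
  have no_crit: "(\<nexists>r. 1 < r \<and> critical_point (?U K) r) \<and>
      (\<forall>r>1. ?U K differentiable (at r) \<and> deriv (?U K) r > 0) \<and> strict_mono_on {1<..} (?U K)"
    if K: "K \<in> {-K0<..<K0}" for K
  proof (intro conjI)
    show "strict_mono_on {1<..} (?U K)"
    proof (rule strict_mono_onI)
      fix r s :: real assume rs: "r \<in> {1<..}" "s \<in> {1<..}" "r < s"
      show "?U K r < ?U K s"
      proof (rule DERIV_pos_imp_increasing[OF rs(3)])
        fix t assume "r \<le> t" "t \<le> s"
        then have t: "t > 1" using rs by auto
        then have "(?G t - K\<^sup>2) / t ^ 3 > 0" using small[OF K t] by simp
        then show "\<exists>y. (?U K has_real_derivative y) (at t) \<and> y > 0"
          using effective_potential_deriv[OF t] by blast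
      qed
    qed
  qed (use U' small[OF K] in force)+
  have abs_ge: "\<bar>K\<bar> \<ge> K0" if "K \<notin> {-K0<..<K0}" for K
    using that by auto
  have crit: "{r. 1 < r \<and> critical_point (?U K) r} = {r1 \<bar>K\<bar>, r2 \<bar>K\<bar>}" if "K \<notin> {-K0<..<K0}" for K
  proof -
    note k = abs_ge[OF that]
    have "?G r = K\<^sup>2 \<longleftrightarrow> r = r1 \<bar>K\<bar> \<or> r = r2 \<bar>K\<bar>" if "r > 1" for r
      using outside[OF k that] inside[OF k, of r] r1[OF k] r2[OF k]
      by (cases "r < r1 \<bar>K\<bar>"; cases "r > r2 \<bar>K\<bar>"; cases "r = r1 \<bar>K\<bar>"; cases "r = r2 \<bar>K\<bar>") auto
    then show ?thesis using U'(3) r1[OF k] r2[OF k] r0(1) by fastforce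
  qed
  have signs: "(\<forall>r>1. r < r1 \<bar>K\<bar> \<or> r2 \<bar>K\<bar> < r \<longrightarrow>
         ?U K differentiable (at r) \<and> deriv (?U K) r > 0) \<and>
      (\<forall>r. r1 \<bar>K\<bar> < r \<and> r < r2 \<bar>K\<bar> \<longrightarrow>
         ?U K differentiable (at r) \<and> deriv (?U K) r < 0)" if "K \<notin> {-K0<..<K0}" for K
  proof (intro conjI allI impI)
    note k = abs_ge[OF that]
    fix r
    { assume r: "r > 1" "r < r1 \<bar>K\<bar> \<or> r2 \<bar>K\<bar> < r"
      then show "?U K differentiable (at r)" "deriv (?U K) r > 0"
        using U'(1,2)[of r K] outside[OF k r] by simp_all }
    assume r: "r1 \<bar>K\<bar> < r \<and> r < r2 \<bar>K\<bar>"
    then have "r > 1" using r1[OF k] by auto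
    then show "?U K differentiable (at r)" "deriv (?U K) r < 0"
      using U'(1,2)[of r K] inside[OF k, of r] r by (simp_all add: divide_neg_pos)
  qed
  have U_critical: "eventually (\<lambda>K. critical_value lam (\<rho> K) = ?U K (\<rho> K)) at_top"
    if "\<And>k. k \<ge> K0 \<Longrightarrow> ?G (\<rho> k) = k\<^sup>2" for \<rho>
    using eventually_ge_at_top[of K0]
    by eventually_elim (simp add: critical_value_def effective_potential_def that)
  have "filterlim (\<lambda>K. critical_value lam (r1 K)) at_top at_top"
    by (rule filterlim_compose[OF critical_value_at_right_1[OF assms] r1_lim])
  then have U_r1: "filterlim (\<lambda>K. ?U K (r1 K)) at_top at_top"
    using filterlim_cong[OF refl refl U_critical[of r1]] r1 by blast
  have "((\<lambda>K. critical_value lam (r2 K)) \<longlongrightarrow> 0) at_top"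
    by (rule filterlim_compose[OF critical_value_tendsto_0 r2_lim])
  then have U_r2: "((\<lambda>K. ?U K (r2 K)) \<longlongrightarrow> 0) at_top"
    by (rule Lim_transform_eventually) (use U_critical r2 in blast)
  have r1_tendsto: "(r1 \<longlongrightarrow> 1) at_top"
    using r1_lim by (simp add: filterlim_at)
  have order: "\<forall>k\<ge>K0. 1 < r1 k \<and> r1 k \<le> r0 \<and> r0 \<le> r2 k"
    using r1 r2 by blast
  have V'_all: "\<forall>r>1. ?V differentiable (at r) \<and> deriv ?V r > 0"
    using V' by blast
  have U_all: "\<forall>K. \<forall>r>1. ?V differentiable (at r) \<and> deriv ?V r > 0"
      "\<forall>K. filterlim (?U K) at_bot (at_right 1)" "\<forall>K. (?U K \<longlongrightarrow> 0) at_top"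
    using V' effective_potential_at_bot[OF assms] effective_potential_tendsto_0 by blast+
  show ?thesis
    unfolding U_minus
    by (rule conjI, fact V'_all, (rule conjI, fact U_all)+,
        rule exI[of _ K0], rule exI[of _ r0], rule exI[of _ r1], rule exI[of _ r2], intro conjI)
       (fact K0(1) r0 r1_cont r2_cont order r1_K0 r2_K0 r1_mono r1_tendsto r2_mono r2_lim U_r1 U_r2
        | rule ballI, erule no_crit | rule allI, rule impI, erule crit | rule allI, rule impI, erule signs)+
qed

end
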